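(* Let $C_{CW}$ be a constant with the Carbery–Wright property described in the context. Let $\delta>0$ be such that $1/\delta$ is an integer. If $f:\mathbb{R}^n\to\mathbb{R}$ is a homogeneous polynomial of degree at most $r$ with $\|f\|_2=1$, then for every $\alpha>0$, $$\Pr_{v \text{ uniform on } G_\delta}\big[|f(v)|\le \alpha-\delta\cdot(8nr^2)^{n+1}\big]\le C_{CW}\cdot r\cdot\alpha^{1/r}.$$
   Context: $\|f\|_2=(\mathbb{E}_x[f(x)^2])^{1/2}$ with $x$ uniform on $[-1,1]^n$. Carbery–Wright property: for all positive integers $n,r$, every polynomial $f:\mathbb{R}^n\to\mathbb{R}$ of degree at most $r$ with $\|f\|_2=1$, and every $\alpha>0$, $\Pr_{v\text{ uniform on }[-1,1)^n}[|f(v)|\le\alpha]\le C_{CW}\,r\,\alpha^{1/r}$. $G_\delta=\{-1,-1+\delta,-1+2\delta,\dots,1-2\delta,1-\delta\}^n$. *)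

theory Defs
  imports "HOL-Probability.Probability" "HOL-Library.Poly_Mapping"
begin

text \<open>
  Real polynomials in the variables \<open>x\<^sub>0, x\<^sub>1, \<dots>\<close> are finitely supported maps from monomials
  (exponent vectors) to coefficients. Points of \<open>\<real>\<^sup>n\<close> are functions on the index set \<open>{..<n}\<close>,
  since the Carbery--Wright property quantifies over \<open>n\<close>.
\<close>

type_synonym mpoly_real = "(nat \<Rightarrow>\<^sub>0 nat) \<Rightarrow>\<^sub>0 real"

definition eval_poly :: "mpoly_real \<Rightarrow> (nat \<Rightarrow> real) \<Rightarrow> real" where
  "eval_poly p x =
     (\<Sum>m\<in>Poly_Mapping.keys p. Poly_Mapping.lookup p m *
        (\<Prod>i\<in>Poly_Mapping.keys m. x i ^ Poly_Mapping.lookup m i))"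

definition poly_in :: "nat \<Rightarrow> mpoly_real \<Rightarrow> bool" where
  "poly_in n p \<longleftrightarrow> (\<forall>m\<in>Poly_Mapping.keys p. Poly_Mapping.keys m \<subseteq> {..<n})"

definition monom_degree :: "(nat \<Rightarrow>\<^sub>0 nat) \<Rightarrow> nat" where
  "monom_degree m = (\<Sum>i\<in>Poly_Mapping.keys m. Poly_Mapping.lookup m i)"

text \<open>The zero polynomial gets total degree \<open>0\<close>.\<close>

definition total_degree :: "mpoly_real \<Rightarrow> nat" where
  "total_degree p = Max (insert 0 (monom_degree ` Poly_Mapping.keys p))"

definition homogeneous :: "mpoly_real \<Rightarrow> bool" where
  "homogeneous p \<longleftrightarrow> (\<exists>d. \<forall>m\<in>Poly_Mapping.keys p. monom_degree m = d)"

definition uniform_box :: "nat \<Rightarrow> real set \<Rightarrow> (nat \<Rightarrow> real) measure" where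
  "uniform_box n I = uniform_measure (Pi\<^sub>M {..<n} (\<lambda>_. lborel)) (Pi\<^sub>E {..<n} (\<lambda>_. I))"

definition norm2 :: "nat \<Rightarrow> ((nat \<Rightarrow> real) \<Rightarrow> real) \<Rightarrow> real" where
  "norm2 n f = sqrt (\<integral>x. (f x)\<^sup>2 \<partial>uniform_box n {-1..1})"

definition carbery_wright :: "real \<Rightarrow> bool" where
  "carbery_wright C \<longleftrightarrow>
     (\<forall>n r p \<alpha>. n > 0 \<longrightarrow> r > 0 \<longrightarrow> poly_in n p \<longrightarrow> total_degree p \<le> r \<longrightarrow>
        norm2 n (eval_poly p) = 1 \<longrightarrow> \<alpha> > 0 \<longrightarrow>
        measure (uniform_box n {-1..<1})
          {v \<in> space (uniform_box n {-1..<1}). \<bar>eval_poly p v\<bar> \<le> \<alpha>}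
          \<le> C * real r * \<alpha> powr (1 / real r))"

definition grid :: "nat \<Rightarrow> real \<Rightarrow> (nat \<Rightarrow> real) set" where
  "grid n \<delta> = Pi\<^sub>E {..<n} (\<lambda>_. {-1 + real j * \<delta> | j. -1 + real j * \<delta> \<le> 1 - \<delta>})"

end

theory Submission
  imports Defs
begin

text \<open>
  Rounding a uniform point of \<open>[-1,1)\<^sup>n\<close> down to the grid gives a uniform grid point and moves
  each coordinate by at most \<open>\<delta>\<close>, so it suffices that \<open>f\<close> is Lipschitz on the cube.
  Along each coordinate \<open>f\<close> is a univariate polynomial of degree at most \<open>r\<close>. A Markov-type
  inequality, applied in one coordinate after the other, bounds the supremum of \<open>f\<close>
  by \<open>(6r)\<^sup>n\<close> times its \<open>L\<^sup>2\<close> norm, and then the change in each coordinate.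
\<close>

section \<open>Chebyshev polynomials\<close>

fun chebyshev :: "nat \<Rightarrow> real poly" where
  "chebyshev 0 = 1"
| "chebyshev (Suc 0) = [:0, 1:]"
| "chebyshev (Suc (Suc n)) = [:0, 2:] * chebyshev (Suc n) - chebyshev n"

lemma degree_chebyshev: "degree (chebyshev n) \<le> n"
proof (induction n rule: chebyshev.induct)
  case (3 n)
  have "degree ([:0, 2:] * chebyshev (Suc n)) \<le> 1 + Suc n"
    using 3 degree_mult_le[of "[:0, 2:]" "chebyshev (Suc n)"] by simp
  with 3 show ?case by (auto intro!: degree_diff_le)
qed auto

lemma poly_chebyshev_cos: "poly (chebyshev n) (cos t) = cos (real n * t)"
proof (induction n rule: chebyshev.induct)
  case (3 n)
  have "real (Suc (Suc n)) * t = real (Suc n) * t + t" "real n * t = real (Suc n) * t - t"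
    by (simp_all add: algebra_simps)
  then have "cos (real (Suc (Suc n)) * t) + cos (real n * t) = 2 * cos t * cos (real (Suc n) * t)"
    by (simp only: cos_add cos_diff) (simp add: algebra_simps)
  with 3 show ?case by simp
qed auto

lemma poly_chebyshev_1: "poly (chebyshev n) 1 = 1"
  using poly_chebyshev_cos[of n 0] by simp

text \<open>Differentiating the recurrence at 1 gives d(n+2) = 2 + 2 d(n+1) - d(n), which squares
  satisfy. This value is the constant in the endpoint inequality below.\<close>

lemma poly_pderiv_chebyshev_1: "poly (pderiv (chebyshev n)) 1 = (real n)\<^sup>2"
proof (induction n rule: chebyshev.induct)
  case (3 n)
  then show ?case
    by (simp add: pderiv_diff pderiv_mult pderiv_pCons pderiv_smult poly_chebyshev_1
        power2_eq_square algebra_simps)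
qed (auto simp: pderiv_pCons)

section \<open>Markov-type inequality on an interval\<close>

text \<open>Root counting: the sign changes give r zeros of \<open>p\<close> below
  \<open>y 0\<close>, and Rolle gives r - 1 critical points between them. A critical point at
  \<open>b\<close>, to the right of all these, would be an r-th root of \<open>pderiv p\<close>,
  which is nonzero of degree at most r - 1.\<close>

lemma alternating_poly_critical_point:
  fixes p :: "real poly"
  assumes "degree p \<le> r" "r > 0"
    and dec: "\<And>k. k < r \<Longrightarrow> y (Suc k) < y k"
    and alt: "\<And>k. k \<le> r \<Longrightarrow> (-1) ^ k * poly p (y k) > 0"
    and "y 0 \<le> b"
  shows "poly (pderiv p) b \<noteq> 0"
proof
  assume crit: "poly (pderiv p) b = 0"
  have "\<exists>z. y (Suc k) < z \<and> z < y k \<and> poly p z = 0" if "k < r" for k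
  proof -
    have "poly p (y (Suc k)) * poly p (y k) < 0"
    proof (cases "even k")
      case True
      then have "poly p (y k) > 0" "poly p (y (Suc k)) < 0"
        using alt[of k] alt[of "Suc k"] that by auto
      then show ?thesis by (rule mult_neg_pos[rotated])
    next
      case False
      then have "poly p (y k) < 0" "poly p (y (Suc k)) > 0"
        using alt[of k] alt[of "Suc k"] that by auto
      then show ?thesis by (rule mult_pos_neg[rotated])
    qed
    then show ?thesis using poly_IVT[OF dec[OF that]] by blast
  qed
  then obtain z where z: "\<And>k. k < r \<Longrightarrow> y (Suc k) < z k \<and> z k < y k \<and> poly p (z k) = 0"
    by metis
  \<comment> \<open>Index 0 is reserved for the supposed critical point \<open>b\<close>; each later
    index k takes the Rolle point between zeros k and k - 1. The resulting sequence is strictly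
    decreasing, hence injective.\<close>
  have "\<exists>w. poly (pderiv p) w = 0 \<and> (if k = 0 then w = b else z k < w \<and> w < z (k - 1))"
    if "k < r" for k
  proof (cases k)
    case 0
    then show ?thesis using crit by auto
  next
    case (Suc j)
    have "z k < z j" using z[of k] z[of j] Suc that by auto
    then obtain w where "z k < w" "w < z j" 
      "poly p (z j) - poly p (z k) = (z j - z k) * poly (pderiv p) w"
      using poly_MVT by blast
    then show ?thesis using z[of k] z[of j] Suc that by auto
  qed
  then obtain w where w: "\<And>k. k < r \<Longrightarrow> poly (pderiv p) (w k) = 0"
    "\<And>k. k < r \<Longrightarrow> if k = 0 then w k = b else z k < w k \<and> w k < z (k - 1)"
    by metis
  have step: "w (Suc k) < w k" if "Suc k < r" for k
    using w(2)[of k] w(2)[of "Suc k"] z[of 0] that \<open>y 0 \<le> b\<close> by (auto split: if_splits)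
  have mono: "w k < w j" if "j < k" "k < r" for j k
    using that
  proof (induction k)
    case (Suc k)
    then show ?case using step[of k] by (cases "j = k") auto
  qed simp
  have inj: "inj_on w {..<r}"
    unfolding inj_on_def by (metis lessThan_iff linorder_neqE_nat mono order_less_irrefl)
  have "pderiv p \<noteq> 0"
  proof
    assume "pderiv p = 0"
    then obtain c where "p = [:c:]"
      by (metis pderiv_eq_0_iff degree_eq_zeroE)
    then show False using alt[of 0] alt[of 1] \<open>r > 0\<close> by auto
  qed
  moreover have "w ` {..<r} \<subseteq> {x. poly (pderiv p) x = 0}" using w(1) by auto
  ultimately have "card (w ` {..<r}) \<le> degree (pderiv p)"
    using card_mono[OF poly_roots_finite] card_poly_roots_bound[of "pderiv p"]
    by (blast intro: order.trans)
  then show False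
    using inj \<open>degree p \<le> r\<close> \<open>r > 0\<close> by (simp add: card_image degree_pderiv)
qed

text \<open>
  If the bound failed, a multiple of \<open>q\<close> with supremum less than \<open>1\<close> would have the same
  derivative at \<open>1\<close> as the Chebyshev polynomial; the difference alternates in sign at the
  Chebyshev extrema, so that all its critical points lie in the open interval.
\<close>

lemma markov_inequality_endpoint:
  fixes q :: "real poly"
  assumes deg: "degree q \<le> r" and "r > 0"
    and bound: "\<And>x. -1 \<le> x \<Longrightarrow> x \<le> 1 \<Longrightarrow> \<bar>poly q x\<bar> \<le> M"
  shows "\<bar>poly (pderiv q) 1\<bar> \<le> (real r)\<^sup>2 * M"
proof (rule ccontr)
  define d where "d = poly (pderiv q) 1"
  define l where "l = (real r)\<^sup>2 / d"
  define p where "p = chebyshev r - smult l q"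
  \<comment> \<open>The extrema of the Chebyshev polynomial, descending from 1 at k = 0 to -1 at k =
    r. Its values there are plus or minus 1, so subtracting a quantity of modulus below 1 keeps the
    signs.\<close>
  define y where "y k = cos (real k * pi / real r)" for k
  assume "\<not> ?thesis"
  then have d: "(real r)\<^sup>2 * M < \<bar>d\<bar>" by (simp add: d_def)
  have "M \<ge> 0" using bound[of 0] by simp
  with d have "d \<noteq> 0" by (smt (verit) mult_nonneg_nonneg zero_le_power2)
  with d have lM: "\<bar>l\<bar> * M < 1"
    by (simp add: l_def abs_div field_simps)
  have "degree p \<le> r"
    unfolding p_def using degree_chebyshev deg
    by (intro degree_diff_le) (auto intro: order.trans[OF degree_smult_le])
  moreover have "y (Suc k) < y k" if "k < r" for k
    unfolding y_def
  proof (rule cos_monotone_0_pi)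
    show "real (Suc k) * pi / real r \<le> pi"
      using that mult_right_mono[of "real (Suc k)" "real r" pi] by (simp add: field_simps)
  qed (use \<open>r > 0\<close> in \<open>auto intro!: divide_strict_right_mono\<close>)
  moreover have "(-1) ^ k * poly p (y k) > 0" if "k \<le> r" for k
  proof -
    have "poly (chebyshev r) (y k) = cos (real k * pi)"
      using \<open>r > 0\<close> by (simp add: y_def poly_chebyshev_cos)
    then have c: "poly (chebyshev r) (y k) = (-1) ^ k" by (simp add: cos_npi)
    have "\<bar>l * poly q (y k)\<bar> \<le> \<bar>l\<bar> * M"
      using bound[of "y k"] by (simp add: y_def abs_mult mult_left_mono)
    with lM have "\<bar>l * poly q (y k)\<bar> < 1" by linarith
    then show ?thesis by (cases "even k") (auto simp: p_def c)
  qed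
  ultimately have "poly (pderiv p) 1 \<noteq> 0"
    using \<open>r > 0\<close> by (intro alternating_poly_critical_point[of p r y]) (auto simp: y_def)
  then show False
    using \<open>d \<noteq> 0\<close>
    by (simp add: p_def pderiv_diff pderiv_smult poly_pderiv_chebyshev_1 l_def flip: d_def)
qed

text \<open>The endpoint inequality is applied to the segment from x to the farther endpoint. That
  segment has half-length at least 1/2, so rescaling costs at most a factor 2.\<close>

lemma markov_inequality_weak:
  fixes q :: "real poly"
  assumes deg: "degree q \<le> r" and "r > 0"
    and bound: "\<And>x. -1 \<le> x \<Longrightarrow> x \<le> 1 \<Longrightarrow> \<bar>poly q x\<bar> \<le> M"
    and x: "-1 \<le> x" "x \<le> 1"
  shows "\<bar>poly (pderiv q) x\<bar> \<le> 2 * (real r)\<^sup>2 * M"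
proof -
  \<comment> \<open>The affine map \<open>s \<mapsto> x - c + c s\<close> sends \<open>1\<close> to \<open>x\<close> and \<open>-1\<close> to the farther endpoint.\<close>
  define c where "c = (if x \<le> 0 then - (1 - x) / 2 else (1 + x) / 2)"
  define Q where "Q = pcompose q [:x - c, c:]"
  have "degree Q \<le> r"
    using deg degree_pcompose_le[of q "[:x - c, c:]"] by (auto simp: Q_def split: if_splits)
  moreover have "\<bar>poly Q s\<bar> \<le> M" if "-1 \<le> s" "s \<le> 1" for s
  proof -
    have "0 \<le> (1 - x) * (1 - s)" "0 \<le> (1 - x) * (1 + s)" "0 \<le> (1 + x) * (1 - s)"
      "0 \<le> (1 + x) * (1 + s)"
      using x that by auto
    then have "-1 \<le> x - c + s * c" "x - c + s * c \<le> 1"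
      using x that by (auto simp: c_def field_simps)
    then show ?thesis using bound by (simp add: Q_def poly_pcompose)
  qed
  ultimately have "\<bar>poly (pderiv Q) 1\<bar> \<le> (real r)\<^sup>2 * M"
    using \<open>r > 0\<close> by (intro markov_inequality_endpoint)
  also have "poly (pderiv Q) 1 = c * poly (pderiv q) x"
    by (simp add: Q_def pderiv_pcompose poly_pcompose pderiv_pCons)
  finally have *: "\<bar>c\<bar> * \<bar>poly (pderiv q) x\<bar> \<le> (real r)\<^sup>2 * M" by (simp add: abs_mult)
  have "1 / 2 \<le> \<bar>c\<bar>" using x by (auto simp: c_def)
  then have "1 / 2 * \<bar>poly (pderiv q) x\<bar> \<le> \<bar>c\<bar> * \<bar>poly (pderiv q) x\<bar>"
    by (intro mult_right_mono) auto
  with * show ?thesis by simp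
qed

section \<open>Lipschitz and mean-square estimates in one variable\<close>

lemma poly_lipschitz_of_bounded:
  fixes q :: "real poly"
  assumes deg: "degree q \<le> r" and "r > 0"
    and bound: "\<And>x. -1 \<le> x \<Longrightarrow> x \<le> 1 \<Longrightarrow> \<bar>poly q x\<bar> \<le> M"
    and "s \<in> {-1..1}" "t \<in> {-1..1}"
  shows "\<bar>poly q s - poly q t\<bar> \<le> 2 * (real r)\<^sup>2 * M * \<bar>s - t\<bar>"
proof -
  have less: "\<bar>poly q b - poly q a\<bar> \<le> 2 * (real r)\<^sup>2 * M * \<bar>b - a\<bar>"
    if "a < b" "a \<in> {-1..1}" "b \<in> {-1..1}" for a b
  proof -
    obtain u where u: "a < u" "u < b" "poly q b - poly q a = (b - a) * poly (pderiv q) u"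
      using poly_MVT[OF \<open>a < b\<close>] by blast
    have "\<bar>poly (pderiv q) u\<bar> \<le> 2 * (real r)\<^sup>2 * M"
      using u that by (intro markov_inequality_weak[OF deg \<open>r > 0\<close> bound]) auto
    then show ?thesis
      unfolding u(3) abs_mult by (subst mult.commute) (intro mult_right_mono, auto)
  qed
  consider "s < t" | "s = t" | "t < s" by linarith
  then show ?thesis
    using less[of s t] less[of t s] assms(4,5) by cases (auto simp: abs_minus_commute)
qed

text \<open>
  By the Lipschitz bound, \<open>\<bar>q\<bar>\<close> stays above half its maximum on an interval of length
  \<open>1 / (4 r\<^sup>2)\<close>.
\<close>

lemma poly_square_le_nn_integral:
  fixes q :: "real poly"
  assumes deg: "degree q \<le> r" and "r > 0" and x: "x \<in> {-1..1}"
  shows "ennreal ((poly q x)\<^sup>2) \<le>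
    ennreal (18 * (real r)\<^sup>2) * (\<integral>\<^sup>+t. ennreal ((poly q t)\<^sup>2) * indicator {-1..1} t \<partial>lborel)"
proof -
  have "\<exists>x0\<in>{-1..1}. \<forall>t\<in>{-1..1}. \<bar>poly q t\<bar> \<le> \<bar>poly q x0\<bar>"
    by (intro continuous_attains_sup) (auto intro!: continuous_intros)
  then obtain x0 where x0: "x0 \<in> {-1..1}" "\<And>t. t \<in> {-1..1} \<Longrightarrow> \<bar>poly q t\<bar> \<le> \<bar>poly q x0\<bar>"
    by blast
  define M where "M = \<bar>poly q x0\<bar>"
  have "M \<ge> 0" by (simp add: M_def)
  define h where "h = 1 / (4 * (real r)\<^sup>2)"
  have r1: "1 \<le> (real r)\<^sup>2" using \<open>r > 0\<close> by simp
  have h: "0 < h" "h \<le> 1"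
  proof -
    show "0 < h" using \<open>r > 0\<close> by (simp add: h_def)
    have "1 \<le> 4 * (real r)\<^sup>2" using r1 by linarith
    then show "h \<le> 1" unfolding h_def by (intro divide_le_eq_1[THEN iffD2]) linarith
  qed
  \<comment> \<open>The interval extends from the maximiser towards the origin, so
    \<open>h \<le> 1\<close> keeps it inside [-1,1].\<close>
  define a where "a = (if x0 \<le> 0 then x0 else x0 - h)"
  have J: "{a..a + h} \<subseteq> {-1..1}" "\<And>t. t \<in> {a..a + h} \<Longrightarrow> \<bar>t - x0\<bar> \<le> h"
    using x0(1) h by (auto simp: a_def split: if_splits)
  have half: "M / 2 \<le> \<bar>poly q t\<bar>" if "t \<in> {a..a + h}" for t
  proof -
    have "\<bar>poly q t - poly q x0\<bar> \<le> 2 * (real r)\<^sup>2 * M * \<bar>t - x0\<bar>"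
      using J that x0
      by (intro poly_lipschitz_of_bounded[OF deg \<open>r > 0\<close>]) (auto simp: M_def)
    also have "\<dots> \<le> 2 * (real r)\<^sup>2 * M * h"
      using J(2)[OF that] \<open>M \<ge> 0\<close> by (intro mult_left_mono) auto
    also have "\<dots> = M / 2" using \<open>r > 0\<close> by (simp add: h_def field_simps)
    finally show ?thesis unfolding M_def by linarith
  qed
  have "ennreal ((M / 2)\<^sup>2 * h) = (\<integral>\<^sup>+t. ennreal ((M / 2)\<^sup>2) * indicator {a..a + h} t \<partial>lborel)"
    using h by (simp add: nn_integral_cmult_indicator ennreal_mult)
  also have "\<dots> \<le> (\<integral>\<^sup>+t. ennreal ((poly q t)\<^sup>2) * indicator {-1..1} t \<partial>lborel)"
  proof (intro nn_integral_mono)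
    fix t :: real
    show "ennreal ((M / 2)\<^sup>2) * indicator {a..a + h} t
        \<le> ennreal ((poly q t)\<^sup>2) * indicator {-1..1} t"
    proof (cases "t \<in> {a..a + h}")
      case True
      have "(M / 2)\<^sup>2 \<le> \<bar>poly q t\<bar>\<^sup>2" using half[OF True] \<open>M \<ge> 0\<close> by (intro power_mono) auto
      with True J(1) show ?thesis by (auto simp: indicator_def intro!: ennreal_leI)
    qed simp
  qed
  finally have int: "ennreal ((M / 2)\<^sup>2 * h)
    \<le> (\<integral>\<^sup>+t. ennreal ((poly q t)\<^sup>2) * indicator {-1..1} t \<partial>lborel)" .
  have "(poly q x)\<^sup>2 \<le> M\<^sup>2"
    using x0(2)[OF x] by (simp add: M_def abs_le_square_iff)
  \<comment> \<open>The right side is 18/16 of \<open>M\<^sup>2\<close>. The constant 18 is chosen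
    because 2 * 18 = 36 is a square, which later yields the base 6 r.\<close>
  also have "\<dots> \<le> 18 * (real r)\<^sup>2 * ((M / 2)\<^sup>2 * h)"
    using \<open>r > 0\<close> by (simp add: h_def power_divide)
  finally have "ennreal ((poly q x)\<^sup>2) \<le> ennreal (18 * (real r)\<^sup>2) * ennreal ((M / 2)\<^sup>2 * h)"
    using h by (simp flip: ennreal_mult)
  also note mult_left_mono[OF int]
  finally show ?thesis by simp
qed

section \<open>Coordinate slices and measurability of multivariate polynomials\<close>

text \<open>This brings the univariate estimates to bear on one coordinate at a time. The exponent
  of a single variable in a monomial never exceeds the total degree.\<close>

lemma eval_poly_slice:
  assumes "total_degree p \<le> r"
  obtains q where "degree q \<le> r" "\<And>t. eval_poly p (x(i := t)) = poly q t"
proof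
  define q where "q = (\<Sum>m\<in>Poly_Mapping.keys p. monom (Poly_Mapping.lookup p m *
    (\<Prod>j\<in>Poly_Mapping.keys m - {i}. x j ^ Poly_Mapping.lookup m j)) (Poly_Mapping.lookup m i))"
  have "Poly_Mapping.lookup m i \<le> r" if "m \<in> Poly_Mapping.keys p" for m
  proof -
    have "Poly_Mapping.lookup m i \<le> monom_degree m"
      unfolding monom_degree_def
      by (cases "i \<in> Poly_Mapping.keys m") (auto simp: in_keys_iff intro: member_le_sum)
    also have "\<dots> \<le> total_degree p"
      unfolding total_degree_def using that by (intro Max_ge) auto
    finally show ?thesis using assms by simp
  qed
  then show "degree q \<le> r"
    unfolding q_def by (intro degree_sum_le) (auto intro: order.trans[OF degree_monom_le])
  show "eval_poly p (x(i := t)) = poly q t" for t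
  proof -
    have "(\<Prod>j\<in>Poly_Mapping.keys m. (x(i := t)) j ^ Poly_Mapping.lookup m j) =
      t ^ Poly_Mapping.lookup m i *
        (\<Prod>j\<in>Poly_Mapping.keys m - {i}. x j ^ Poly_Mapping.lookup m j)" for m
    proof (cases "i \<in> Poly_Mapping.keys m")
      case True
      then show ?thesis by (subst prod.remove[of _ i]) (auto intro!: prod.cong)
    next
      case False
      then show ?thesis by (auto simp: in_keys_iff intro!: prod.cong)
    qed
    then show ?thesis
      by (simp add: eval_poly_def q_def poly_sum poly_monom mult_ac)
  qed
qed

lemma eval_poly_cong:
  assumes "poly_in n p" "\<And>i. i < n \<Longrightarrow> x i = y i"
  shows "eval_poly p x = eval_poly p y"
  unfolding eval_poly_def
proof (intro sum.cong refl arg_cong2[where f = "(*)"] prod.cong)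
  fix m i assume "m \<in> Poly_Mapping.keys p" "i \<in> Poly_Mapping.keys m"
  then have "i < n" using assms(1) by (auto simp: poly_in_def)
  then show "x i ^ Poly_Mapping.lookup m i = y i ^ Poly_Mapping.lookup m i"
    using assms(2) by simp
qed

text \<open>Coordinates outside \<open>I\<close> stay frozen at \<open>x\<close>. Arbitrary
  \<open>I\<close> is allowed because the induction below integrates over a growing set of
  coordinates.\<close>

lemma measurable_eval_poly_override:
  "(\<lambda>y. eval_poly p (override_on x y I)) \<in> borel_measurable (Pi\<^sub>M I (\<lambda>_. lborel))"
proof -
  have "(\<lambda>y. override_on x y I j) \<in> borel_measurable (Pi\<^sub>M I (\<lambda>_. lborel))" for j
    by (cases "j \<in> I") (auto simp: override_on_def)
  then show ?thesis unfolding eval_poly_def by measurable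
qed

lemma borel_measurable_eval_poly:
  assumes "poly_in n p"
  shows "eval_poly p \<in> borel_measurable (Pi\<^sub>M {..<n} (\<lambda>_. lborel))"
proof -
  have "eval_poly p = (\<lambda>y. eval_poly p (override_on (\<lambda>_. 0) y {..<n}))"
    using assms by (auto intro!: eval_poly_cong)
  then show ?thesis using measurable_eval_poly_override by metis
qed

section \<open>Supremum and Lipschitz bounds on the cube\<close>

text \<open>Induction on the set of integrated coordinates: the univariate inequality bounds the
  integrand by an integral over one further coordinate, at the cost of a factor 18 r^2, and Tonelli
  merges the two integrals.\<close>

lemma eval_poly_square_le_nn_integral:
  assumes "total_degree p \<le> r" "r > 0" "finite I" "\<And>i. i \<in> I \<Longrightarrow> x i \<in> {-1..1}"
  shows "ennreal ((eval_poly p x)\<^sup>2) \<le> ennreal (18 * (real r)\<^sup>2) ^ card I *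
    (\<integral>\<^sup>+y. ennreal ((eval_poly p (override_on x y I))\<^sup>2) * (\<Prod>i\<in>I. indicator {-1..1} (y i))
      \<partial>Pi\<^sub>M I (\<lambda>_. lborel))"
  using assms(3,4)
proof (induction I)
  case empty
  interpret product_sigma_finite "\<lambda>_. lborel :: real measure" by standard
  show ?case by (subst nn_integral_empty) auto
next
  case (insert i I)
  interpret product_sigma_finite "\<lambda>_. lborel :: real measure" by standard
  let ?K = "ennreal (18 * (real r)\<^sup>2)"
  let ?F = "\<lambda>I y. ennreal ((eval_poly p (override_on x y I))\<^sup>2) *
    (\<Prod>i\<in>I. indicator {-1..1} (y i))"
  have meas: "?F J \<in> borel_measurable (Pi\<^sub>M J (\<lambda>_. lborel))" for J
    using measurable_eval_poly_override[of p x J] by measurable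
  \<comment> \<open>Coordinate \<open>i\<close> still has the value \<open>x i\<close> on the left,
    so the left side is the slice polynomial at t = \<open>x i\<close>. The indicators of the other
    coordinates are constant in t and pass through the integral.\<close>
  have slice: "?F I y \<le> ?K * (\<integral>\<^sup>+t. ?F (insert i I) (y(i := t)) \<partial>lborel)"
    for y
  proof -
    let ?z = "override_on x y I"
    obtain q where q: "degree q \<le> r" "\<And>t. eval_poly p (?z(i := t)) = poly q t"
      using eval_poly_slice[OF assms(1)] by blast
    have zi: "?z(i := x i) = ?z" using \<open>i \<notin> I\<close> by (auto simp: override_on_def)
    have upd: "override_on x (y(i := t)) (insert i I) = ?z(i := t)" for t
      using \<open>i \<notin> I\<close> by (auto simp: override_on_def)
    have ind: "(\<Prod>j\<in>insert i I. indicator {-1..1} ((y(i := t)) j)) =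
      indicator {-1..1} t * (\<Prod>j\<in>I. indicator {-1..1} (y j) :: ennreal)" for t
    proof -
      have "(\<Prod>j\<in>I. indicator {-1..1} ((y(i := t)) j)) =
        (\<Prod>j\<in>I. indicator {-1..1} (y j) :: ennreal)"
        using \<open>i \<notin> I\<close> by (intro prod.cong) auto
      then show ?thesis using insert(1,2) by simp
    qed
    have "ennreal ((eval_poly p ?z)\<^sup>2) \<le>
      ?K * (\<integral>\<^sup>+t. ennreal ((poly q t)\<^sup>2) * indicator {-1..1} t \<partial>lborel)"
      using poly_square_le_nn_integral[OF q(1) \<open>r > 0\<close>, of "x i"] insert(4)[of i] zi
      by (simp flip: q(2))
    then have "?F I y \<le> ?K * (\<integral>\<^sup>+t. ennreal ((poly q t)\<^sup>2) * indicator {-1..1} t \<partial>lborel)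
      * (\<Prod>j\<in>I. indicator {-1..1} (y j))"
      by (rule mult_right_mono) simp
    also have "\<dots> = ?K * (\<integral>\<^sup>+t. ennreal ((poly q t)\<^sup>2) * indicator {-1..1} t *
      (\<Prod>j\<in>I. indicator {-1..1} (y j)) \<partial>lborel)"
          proof (subst nn_integral_multc)
      have [measurable]: "poly q \<in> borel_measurable borel"
        by (intro borel_measurable_continuous_onI continuous_on_poly continuous_on_id)
      show "(\<lambda>t. ennreal ((poly q t)\<^sup>2) * indicator {-1..1} t) \<in> borel_measurable lborel"
        by measurable
    qed (simp add: mult.assoc)
    also have "\<dots> = ?K * (\<integral>\<^sup>+t. ?F (insert i I) (y(i := t)) \<partial>lborel)"
      unfolding upd ind q(2) by (simp add: mult.assoc)
    finally show ?thesis .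
  qed
  have "ennreal ((eval_poly p x)\<^sup>2) \<le> ?K ^ card I * (\<integral>\<^sup>+y. ?F I y \<partial>Pi\<^sub>M I (\<lambda>_. lborel))"
    using insert by simp
  also have "\<dots> \<le> ?K ^ card I *
    (\<integral>\<^sup>+y. ?K * (\<integral>\<^sup>+t. ?F (insert i I) (y(i := t)) \<partial>lborel) \<partial>Pi\<^sub>M I (\<lambda>_. lborel))"
    by (intro mult_left_mono nn_integral_mono slice) auto
  also have "\<dots> = ?K ^ card I * (?K *
    (\<integral>\<^sup>+y. (\<integral>\<^sup>+t. ?F (insert i I) (y(i := t)) \<partial>lborel) \<partial>Pi\<^sub>M I (\<lambda>_. lborel)))"
  proof (subst nn_integral_cmult)
    have "(\<lambda>(y, t). ?F (insert i I) (y(i := t))) \<in>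
      borel_measurable (Pi\<^sub>M I (\<lambda>_. lborel) \<Otimes>\<^sub>M lborel)"
      using measurable_compose[OF measurable_add_dim meas] by (simp add: case_prod_beta)
    then show "(\<lambda>y. \<integral>\<^sup>+t. ?F (insert i I) (y(i := t)) \<partial>lborel) \<in>
      borel_measurable (Pi\<^sub>M I (\<lambda>_. lborel))"
      by (rule lborel.borel_measurable_nn_integral)
  qed simp
  also have "\<dots> = ?K ^ card (insert i I) *
    (\<integral>\<^sup>+y. ?F (insert i I) y \<partial>Pi\<^sub>M (insert i I) (\<lambda>_. lborel))"
    using insert(1,2) by (subst product_nn_integral_insert[OF _ _ meas]) (auto simp: mult_ac)
  finally show ?case .
qed

lemma emeasure_lborel_PiE:
  assumes "finite I" "\<And>i. i \<in> I \<Longrightarrow> A i \<in> sets borel"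
  shows "emeasure (Pi\<^sub>M I (\<lambda>_. lborel)) (Pi\<^sub>E I A) = (\<Prod>i\<in>I. emeasure lborel (A i :: real set))"
proof -
  interpret product_sigma_finite "\<lambda>_. lborel :: real measure" by standard
  show ?thesis using assms by (intro emeasure_PiM) auto
qed

text \<open>Normalisation makes the integral of the square over the cube equal to its volume 2^n.
  The preceding lemma then bounds the square by (18 r^2)^n 2^n = ((6 r)^n)^2.\<close>

lemma eval_poly_bound:
  assumes "poly_in n p" "total_degree p \<le> r" "r > 0" "norm2 n (eval_poly p) = 1"
    and x: "\<And>i. i < n \<Longrightarrow> x i \<in> {-1..1}"
  shows "\<bar>eval_poly p x\<bar> \<le> (6 * real r) ^ n"
proof -
  let ?P = "Pi\<^sub>M {..<n} (\<lambda>_. lborel :: real measure)"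
  let ?B = "Pi\<^sub>E {..<n} (\<lambda>_. {-1..1::real})"
  let ?U = "uniform_box n {-1..1}"
  have intU: "(\<integral>x. (eval_poly p x)\<^sup>2 \<partial>?U) = 1"
    using assms(4) by (simp add: norm2_def)
  \<comment> \<open>A non-integrable function has Bochner integral 0 by convention, so the value 1
    forces integrability.\<close>
  then have "integrable ?U (\<lambda>x. (eval_poly p x)\<^sup>2)"
    using not_integrable_integral_eq by force
  then have 1: "(\<integral>\<^sup>+x. ennreal ((eval_poly p x)\<^sup>2) \<partial>?U) = 1"
    using intU by (simp add: nn_integral_eq_integral)
  have B: "?B \<in> sets ?P" by (intro sets_PiM_I_finite) auto
  have emB: "emeasure ?P ?B = ennreal (2 ^ n)"
    by (simp add: emeasure_lborel_PiE flip: ennreal_power)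
  have [measurable]: "eval_poly p \<in> borel_measurable ?P"
    by (rule borel_measurable_eval_poly[OF assms(1)])
  have "(\<integral>\<^sup>+x. ennreal ((eval_poly p x)\<^sup>2) * indicator ?B x \<partial>?P) / ennreal (2 ^ n) = 1"
    using 1 B unfolding uniform_box_def
    by (subst (asm) nn_integral_uniform_measure) (auto simp: emB)
  then have 2: "(\<integral>\<^sup>+x. ennreal ((eval_poly p x)\<^sup>2) * indicator ?B x \<partial>?P) = ennreal (2 ^ n)"
    by (simp only: divide_eq_1_ennreal)
  have "ennreal ((eval_poly p x)\<^sup>2) \<le> ennreal (18 * (real r)\<^sup>2) ^ n *
    (\<integral>\<^sup>+y. ennreal ((eval_poly p (override_on x y {..<n}))\<^sup>2) *
      (\<Prod>i<n. indicator {-1..1} (y i)) \<partial>?P)"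
    using eval_poly_square_le_nn_integral[OF assms(2,3), of "{..<n}" x] x by simp
  also have "(\<integral>\<^sup>+y. ennreal ((eval_poly p (override_on x y {..<n}))\<^sup>2) *
      (\<Prod>i<n. indicator {-1..1} (y i)) \<partial>?P) =
    (\<integral>\<^sup>+x. ennreal ((eval_poly p x)\<^sup>2) * indicator ?B x \<partial>?P)"
  proof (intro nn_integral_cong arg_cong2[where f = "(*)"])
    fix y assume y: "y \<in> space ?P"
    show "ennreal ((eval_poly p (override_on x y {..<n}))\<^sup>2) = ennreal ((eval_poly p y)\<^sup>2)"
      using eval_poly_cong[OF assms(1), of "override_on x y {..<n}" y] by simp
    show "(\<Prod>i<n. indicator {-1..1} (y i)) = (indicator ?B y :: ennreal)"
      using y by (auto simp: indicator_def PiE_iff space_PiM prod_zero_iff intro!: prod.neutral)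
  qed
  also have "ennreal (18 * (real r)\<^sup>2) ^ n * \<dots> = ennreal (((6 * real r) ^ n)\<^sup>2)"
  proof -
    have "(18 * (real r)\<^sup>2) ^ n * 2 ^ n = (18 * (real r)\<^sup>2 * 2) ^ n"
      by (rule power_mult_distrib[symmetric])
    also have "18 * (real r)\<^sup>2 * 2 = (6 * real r)\<^sup>2"
      by (simp add: power_mult_distrib)
    also have "\<dots> ^ n = ((6 * real r) ^ n)\<^sup>2"
      by (simp only: mult.commute flip: power_mult)
    finally have "ennreal ((18 * (real r)\<^sup>2) ^ n * 2 ^ n) = ennreal (((6 * real r) ^ n)\<^sup>2)"
      by (rule arg_cong)
    then show ?thesis
      unfolding 2 by (subst (asm) ennreal_mult) (simp_all only: ennreal_power zero_le_power
        zero_le_mult_iff zero_le_numeral zero_le_power2 simp_thms)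
  qed
  finally have "(eval_poly p x)\<^sup>2 \<le> ((6 * real r) ^ n)\<^sup>2"
    by (subst (asm) ennreal_le_iff) auto
  then have "\<bar>eval_poly p x\<bar> \<le> \<bar>(6 * real r) ^ n\<bar>"
    by (simp only: abs_le_square_iff)
  then show ?thesis by simp
qed

text \<open>Hybrid argument: \<open>x\<close> is changed into \<open>y\<close> one coordinate at a
  time. Every intermediate point lies in the cube, so each slice is bounded by (6 r)^n there and the
  univariate Lipschitz bound controls each of the n changes.\<close>

lemma eval_poly_lipschitz:
  assumes "poly_in n p" "total_degree p \<le> r" "r > 0" "norm2 n (eval_poly p) = 1"
    and x: "\<And>i. i < n \<Longrightarrow> x i \<in> {-1..1}" and y: "\<And>i. i < n \<Longrightarrow> y i \<in> {-1..1}"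
    and dist: "\<And>i. i < n \<Longrightarrow> \<bar>y i - x i\<bar> \<le> d"
  shows "\<bar>eval_poly p y - eval_poly p x\<bar> \<le> real n * (2 * (real r)\<^sup>2 * (6 * real r) ^ n * d)"
proof -
  let ?L = "2 * (real r)\<^sup>2 * (6 * real r) ^ n"
  have "\<bar>eval_poly p (override_on x y {..<k}) - eval_poly p x\<bar> \<le> real k * (?L * d)"
    if "k \<le> n" for k
    using that
  proof (induction k)
    case (Suc k)
    let ?z = "override_on x y {..<k}"
    have z: "?z i \<in> {-1..1}" if "i < n" for i
      using x[OF that] y[OF that] by (auto simp: override_on_def)
    obtain q where q: "degree q \<le> r" "\<And>t. eval_poly p (?z(k := t)) = poly q t"
      using eval_poly_slice[OF assms(2)] by blast
    have "\<bar>poly q t\<bar> \<le> (6 * real r) ^ n" if "-1 \<le> t" "t \<le> 1" for t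
      unfolding q(2)[symmetric]
      by (rule eval_poly_bound[OF assms(1-4)]) (use z that in auto)
    then have "\<bar>poly q (y k) - poly q (x k)\<bar> \<le> ?L * \<bar>y k - x k\<bar>"
      using x[of k] y[of k] Suc.prems by (intro poly_lipschitz_of_bounded q \<open>r > 0\<close>) auto
    also have "\<dots> \<le> ?L * d"
      using dist[of k] Suc.prems by (intro mult_left_mono) auto
    finally have "\<bar>eval_poly p (?z(k := y k)) - eval_poly p (?z(k := x k))\<bar> \<le> ?L * d"
      by (simp add: q(2))
    moreover have "?z(k := y k) = override_on x y {..<Suc k}" "?z(k := x k) = ?z"
      by (auto simp: override_on_def)
    ultimately have "\<bar>eval_poly p (override_on x y {..<Suc k}) - eval_poly p ?z\<bar> \<le> ?L * d"
      by simp
    with Suc show ?case by (simp add: algebra_simps)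
  qed simp
  from this[of n] show ?thesis
    using eval_poly_cong[OF assms(1), of "override_on x y {..<n}" y] by simp
qed

section \<open>The grid and its cells\<close>

text \<open>For step 1/N the upper limit on a coordinate amounts to j + 1 \<le> 2 N, which leaves
  exactly 2 N values per axis.\<close>

lemma grid_eq:
  assumes "N > 0"
  shows "grid n (1 / real N) = Pi\<^sub>E {..<n} (\<lambda>_. (\<lambda>j. -1 + real j / real N) ` {..<2 * N})"
proof -
  have "- 1 + real j * (1 / real N) \<le> 1 - 1 / real N \<longleftrightarrow> j < 2 * N" for j
  proof -
    have "- 1 + real j * (1 / real N) \<le> 1 - 1 / real N \<longleftrightarrow> real (j + 1) \<le> real (2 * N)"
    proof -
      have "real (j + 1) / real N = real j * (1 / real N) + 1 / real N"
        by (simp add: add_divide_distrib)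
      then have "- 1 + real j * (1 / real N) \<le> 1 - 1 / real N \<longleftrightarrow> real (j + 1) / real N \<le> 2"
        by linarith
      also have "\<dots> \<longleftrightarrow> real (j + 1) \<le> real (2 * N)"
        using assms by (subst pos_divide_le_eq) auto
      finally show ?thesis .
    qed
    then show ?thesis by linarith
  qed
  then have "{-1 + real j * (1 / real N) | j. -1 + real j * (1 / real N) \<le> 1 - 1 / real N} =
    (\<lambda>j. -1 + real j / real N) ` {..<2 * N}"
    by (simp only:) auto
  then show ?thesis by (simp only: grid_def)
qed

lemma grid_gap:
  assumes "N > 0" "g \<in> grid n (1 / real N)" "h \<in> grid n (1 / real N)" "i < n" "g i < h i"
  shows "g i + 1 / real N \<le> h i"
proof -
  have "g i \<in> range (\<lambda>j. -1 + real j / real N)" "h i \<in> range (\<lambda>j. -1 + real j / real N)"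
    using assms(2-4) unfolding grid_eq[OF assms(1)] by (blast dest: PiE_mem)+
  then obtain j k where jk: "g i = -1 + real j / real N" "h i = -1 + real k / real N"
    by blast
  then have "j < k" using assms(1,5) by (simp add: divide_less_cancel)
  then have "real (j + 1) / real N \<le> real k / real N" by (intro divide_right_mono) auto
  then show ?thesis by (simp add: jk add_divide_distrib)
qed

text \<open>This expresses rounding down to the grid. The half-open cells at grid points are
  disjoint and each fills a fraction (2 N)^(-n) of the box, so the cells of \<open>S\<close>, all
  inside \<open>E\<close>, contribute the proportion of \<open>S\<close> in the grid.\<close>

lemma measure_uniform_box_ge_card_grid:
  assumes "N > 0" and S: "S \<subseteq> grid n (1 / real N)"
    and E: "E \<in> sets (Pi\<^sub>M {..<n} (\<lambda>_. lborel))"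
    and cells: "\<And>g. g \<in> S \<Longrightarrow> Pi\<^sub>E {..<n} (\<lambda>i. {g i..<g i + 1 / real N}) \<subseteq> E"
  shows "real (card S) / real (card (grid n (1 / real N))) \<le> measure (uniform_box n {-1..<1}) E"
proof -
  let ?P = "Pi\<^sub>M {..<n} (\<lambda>_. lborel :: real measure)"
  let ?B = "Pi\<^sub>E {..<n} (\<lambda>_. {-1..<1::real})"
  define cell where "cell g = Pi\<^sub>E {..<n} (\<lambda>i. {g i..<g i + 1 / real N})" for g :: "nat \<Rightarrow> real"
  have grid_fin: "finite (grid n (1 / real N))"
    unfolding grid_eq[OF assms(1)] by (intro finite_PiE) auto
  have fin: "finite S" using S grid_fin finite_subset by blast
  have "inj_on (\<lambda>j. -1 + real j / real N) {..<2 * N}"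
    using assms(1) by (auto simp: inj_on_def)
  then have card_grid: "card (grid n (1 / real N)) = (2 * N) ^ n"
    unfolding grid_eq[OF assms(1)] by (simp add: card_PiE card_image)
  have cell_sets: "cell g \<in> sets ?P" for g
    unfolding cell_def by (intro sets_PiM_I_finite) auto
  have cell_measure: "emeasure ?P (cell g) = ennreal ((1 / real N) ^ n)" for g
    unfolding cell_def by (subst emeasure_lborel_PiE) (auto simp: ennreal_power)
  have B: "?B \<in> sets ?P" by (intro sets_PiM_I_finite) auto
  have emB: "emeasure ?P ?B = ennreal (2 ^ n)"
    by (simp add: emeasure_lborel_PiE flip: ennreal_power)
  have cellB: "cell g \<subseteq> ?B" if "g \<in> S" for g
  proof
    fix v assume v: "v \<in> cell g"
    have "v i \<in> {-1..<1}" if "i < n" for i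
    proof -
      have "g i \<in> (\<lambda>j. -1 + real j / real N) ` {..<2 * N}"
        using \<open>g \<in> S\<close> S \<open>i < n\<close> unfolding grid_eq[OF assms(1)] by auto
      then obtain j where j: "g i = -1 + real j / real N" "j < 2 * N" by auto
      have "real (j + 1) \<le> real (2 * N)" using j(2) by linarith
      then have "g i + 1 / real N \<le> 1" "-1 \<le> g i"
        using assms(1) by (auto simp: j(1) field_simps)
      then show ?thesis using v \<open>i < n\<close> by (force simp: cell_def PiE_iff)
    qed
    with v show "v \<in> ?B" by (auto simp: cell_def PiE_iff)
  qed
  have disj: "disjoint_family_on cell S"
  proof (unfold disjoint_family_on_def, intro ballI impI)
    fix g h assume gh: "g \<in> S" "h \<in> S" "g \<noteq> h"
    have gr: "g \<in> grid n (1 / real N)" "h \<in> grid n (1 / real N)" using gh S by auto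
    \<comment> \<open>Grid points are extensional functions, so distinct ones already differ at an
      index below n; \<open>grid_gap\<close> then separates their cells along that axis.\<close>
    then obtain i where i: "i < n" "g i \<noteq> h i"
      using gh(3) PiE_ext[of g "{..<n}" _ h] unfolding grid_def by blast
    have "g i + 1 / real N \<le> h i \<or> h i + 1 / real N \<le> g i"
      using i grid_gap[OF assms(1) gr(1,2)] grid_gap[OF assms(1) gr(2,1)] by force
    then have "v i \<notin> {g i..<g i + 1 / real N} \<inter> {h i..<h i + 1 / real N}" for v :: "nat \<Rightarrow> real"
      by auto
    then show "cell g \<inter> cell h = {}"
      using i(1) unfolding cell_def by (fastforce simp: PiE_iff)
  qed
  have "ennreal (real (card S) * (1 / real N) ^ n) = (\<Sum>g\<in>S. emeasure ?P (cell g))"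
    by (simp add: cell_measure ennreal_mult ennreal_of_nat_eq_real_of_nat)
  also have "\<dots> = emeasure ?P (\<Union>g\<in>S. cell g)"
    using disj cell_sets fin by (intro sum_emeasure) auto
  also have "\<dots> \<le> emeasure ?P (?B \<inter> E)"
    using cells cellB E B unfolding cell_def by (intro emeasure_mono) blast+
  finally have le: "ennreal (real (card S) * (1 / real N) ^ n) \<le> emeasure ?P (?B \<inter> E)" .
  have "emeasure ?P (?B \<inter> E) \<le> ennreal (2 ^ n)"
    unfolding emB[symmetric] using B by (intro emeasure_mono) auto
  then have "emeasure ?P (?B \<inter> E) = ennreal (measure ?P (?B \<inter> E))"
    by (intro emeasure_eq_ennreal_measure) (auto simp: top_unique)
  with le have "real (card S) * (1 / real N) ^ n \<le> measure ?P (?B \<inter> E)"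
    by (simp add: ennreal_le_iff)
  then have "real (card S) * (1 / real N) ^ n / 2 ^ n \<le> measure ?P (?B \<inter> E) / 2 ^ n"
    by (rule divide_right_mono) simp
  moreover have "measure (uniform_box n {-1..<1}) E = measure ?P (?B \<inter> E) / 2 ^ n"
    unfolding uniform_box_def using E emB
    by (subst measure_uniform_measure) (auto simp: measure_def)
  ultimately show ?thesis
    unfolding card_grid by (simp add: power_mult_distrib power_divide mult.commute)
qed

section \<open>Transfer of the Carbery-Wright bound to the grid\<close>

theorem mainTheorem3:
  fixes C \<delta> \<alpha> :: real and n r :: nat and p :: mpoly_real
  assumes "carbery_wright C"
    and "\<delta> > 0" and "1 / \<delta> \<in> \<int>"
    and "n > 0" and "r > 0"
    and "poly_in n p" and "homogeneous p" and "total_degree p \<le> r"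
    and "norm2 n (eval_poly p) = 1"
    and "\<alpha> > 0"
  shows "measure_pmf.prob (pmf_of_set (grid n \<delta>))
           {v. \<bar>eval_poly p v\<bar> \<le> \<alpha> - \<delta> * (8 * real n * (real r)\<^sup>2) ^ (n + 1)}
         \<le> C * real r * \<alpha> powr (1 / real r)"
proof -
  obtain z where z: "1 / \<delta> = of_int z" using assms(3) by (auto elim: Ints_cases)
  define N where "N = nat z"
  have "z > 0" using z assms(2) by (metis of_int_0_less_iff zero_less_divide_1_iff)
  then have N: "N > 0" "\<delta> = 1 / real N"
    using z assms(2) by (auto simp: N_def field_simps)
  let ?L = "(8 * real n * (real r)\<^sup>2) ^ (n + 1)"
  let ?T = "{v. \<bar>eval_poly p v\<bar> \<le> \<alpha> - \<delta> * ?L}"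
  let ?U = "uniform_box n {-1..<1}"
  let ?P = "Pi\<^sub>M {..<n} (\<lambda>_. lborel :: real measure)"
  let ?E = "{v \<in> space ?P. \<bar>eval_poly p v\<bar> \<le> \<alpha>}"
  \<comment> \<open>Since r \<le> n r^2, each factor 6 r is at most 8 n r^2; the remaining factor 2
    n r^2 is absorbed by one more copy, hence the exponent n + 1.\<close>
  have L: "real n * (2 * (real r)\<^sup>2 * (6 * real r) ^ n * \<delta>) \<le> \<delta> * ?L"
  proof -
    have "real r \<le> real n * (real r)\<^sup>2"
      using assms(4,5) mult_mono[of 1 "real n" "real r" "(real r)\<^sup>2"]
      by (simp add: power2_eq_square)
    then have "6 * real r \<le> 8 * real n * (real r)\<^sup>2"
      using of_nat_0_le_iff[of r, where 'a = real] by linarith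
    then have "(6 * real r) ^ n \<le> (8 * real n * (real r)\<^sup>2) ^ n"
      by (rule power_mono) simp
    then have "(2 * real n * (real r)\<^sup>2) * (6 * real r) ^ n \<le>
      (8 * real n * (real r)\<^sup>2) * (8 * real n * (real r)\<^sup>2) ^ n"
      by (rule mult_mono[rotated]) auto
    then have "\<delta> * ((2 * real n * (real r)\<^sup>2) * (6 * real r) ^ n) \<le> \<delta> * ?L"
      using assms(2) by (intro mult_left_mono) auto
    then show ?thesis by (simp add: mult_ac)
  qed
  have grid_fin: "finite (grid n \<delta>)" and grid_ne: "grid n \<delta> \<noteq> {}"
    unfolding N(2) grid_eq[OF N(1)] using N(1)
    by (auto intro!: finite_PiE simp: PiE_eq_empty_iff lessThan_empty_iff)
  have [measurable]: "eval_poly p \<in> borel_measurable ?P"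
    by (rule borel_measurable_eval_poly[OF assms(6)])
  have E: "?E \<in> sets ?P" by measurable
  have "Pi\<^sub>E {..<n} (\<lambda>i. {g i..<g i + 1 / real N}) \<subseteq> ?E" if g: "g \<in> grid n \<delta> \<inter> ?T" for g
  proof
    fix v assume v: "v \<in> Pi\<^sub>E {..<n} (\<lambda>i. {g i..<g i + 1 / real N})"
    \<comment> \<open>The upper limit 1 - \<delta> keeps the whole cell of \<open>g\<close> inside
      the cube, where the Lipschitz bound holds.\<close>
    have gi: "-1 \<le> g i" "g i \<le> 1 - \<delta>" if "i < n" for i
    proof -
      have "g i \<in> {-1 + real j * \<delta> | j. -1 + real j * \<delta> \<le> 1 - \<delta>}"
        using g that unfolding grid_def by blast
      then obtain j where "g i = -1 + real j * \<delta>" "-1 + real j * \<delta> \<le> 1 - \<delta>" by blast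
      then show "-1 \<le> g i" "g i \<le> 1 - \<delta>" using assms(2) by simp_all
    qed
    have vi: "g i \<le> v i" "v i < g i + \<delta>" if "i < n" for i
      using v that by (auto simp: PiE_iff N(2))
    have "\<bar>eval_poly p v - eval_poly p g\<bar> \<le> real n * (2 * (real r)\<^sup>2 * (6 * real r) ^ n * \<delta>)"
    proof (rule eval_poly_lipschitz[OF assms(6,8,5,9)])
      fix i assume "i < n"
      then show "g i \<in> {-1..1}" "v i \<in> {-1..1}" "\<bar>v i - g i\<bar> \<le> \<delta>"
        using gi[of i] vi[of i] assms(2) by auto
    qed
    moreover have "\<bar>eval_poly p g\<bar> \<le> \<alpha> - \<delta> * ?L" using g by simp
    ultimately have "\<bar>eval_poly p v\<bar> \<le> \<alpha>" using L by linarith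
    with v show "v \<in> ?E" by (auto simp: space_PiM PiE_iff)
  qed
  then have "real (card (grid n \<delta> \<inter> ?T)) / real (card (grid n \<delta>)) \<le> measure ?U ?E"
    unfolding N(2) by (intro measure_uniform_box_ge_card_grid[OF N(1) Int_lower1 E])
  also have "?E = {v \<in> space ?U. \<bar>eval_poly p v\<bar> \<le> \<alpha>}"
    by (simp add: uniform_box_def)
  also have "measure ?U \<dots> \<le> C * real r * \<alpha> powr (1 / real r)"
    using assms(1)[unfolded carbery_wright_def, rule_format, OF assms(4,5,6,8,9,10)] .
  finally show ?thesis
    using grid_fin grid_ne by (simp add: measure_pmf_of_set)
qed

end
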